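(* Let $n\ge 1$. The bijection $\varphi: L(3,n)\setminus E_{3,n}\to L(3,n)\setminus S_{3,n}$ defined in the context produces a chain decomposition of $L(3,n)$ into the chains $C_\mu:\ \mu\lessdot\varphi(\mu)\lessdot\varphi^2(\mu)\lessdot\cdots\lessdot\varphi^s(\mu)$, with $\mu\in S_{3,n}$ and $\varphi^s(\mu)\in E_{3,n}$. These chains are of the following two types. (i) $C_\mu$ with $\mu=(4k,2k,0)$, $k=0,1,\dots,\lfloor n/4\rfloor$: starting from $\mu$, one adds $1$ successively to the first, second, third, first, second, third, ... entry, cyclically, until reaching $(n,n-2k,n-4k)$, after $3n-12k$ steps in total. (ii) $C_\mu$ with $\mu=(4k+\ell,2k,0)$, $\ell\ge 2$ and $k=0,1,\dots,\lfloor (n-\ell)/4\rfloor$ (with $\ell\le n$): starting from $\mu$, in steps $1,\dots,2\ell-4$ one adds $1$ alternately to the second and third entries (second first), reaching $(4k+\ell,2k+\ell-2,\ell-2)$; in steps $2\ell-3$ and $2\ell-2$ one adds $1$ to the second entry, reaching $(4k+\ell,2k+\ell,\ell-2)$; thereafter one adds $1$ alternately to the first and second entries (first entry first), until reaching $(n,n-2k,\ell-2)$.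
   Context: $\mathbb{N}=\{0,1,2,\dots\}$. $L(3,n)$ is the poset of integer triples $\lambda=(\lambda_1,\lambda_2,\lambda_3)$ with $n\ge\lambda_1\ge\lambda_2\ge\lambda_3\ge 0$, ordered componentwise; $\lessdot$ denotes the covering relation. The dual of $\lambda$ in $L(3,n)$ is $\lambda^*=(n-\lambda_3,n-\lambda_2,n-\lambda_1)$. For every integer $n\ge0$, $$S_{3,n}=\{(4k+\ell,2k,0): k\in\mathbb{N},\ \ell\in\mathbb{N}\setminus\{1\},\ 4k+\ell\le n,\ 6k+\ell\le 3n/2\},\qquad E_{3,n}=\{\lambda^*:\lambda\in S_{3,n}\}$$ (dual in $L(3,n)$). A triple that is not a partition belongs to no $E_{3,p}$. The map $\varphi$ is defined on $\lambda\in L(3,n)\setminus E_{3,n}$ by: if $\lambda\in E_{3,\lambda_1}$ then $\varphi(\lambda)=(\lambda_1+1,\lambda_2,\lambda_3)$; otherwise, $\varphi(\lambda)=(\lambda_1,\lambda_2+1,\lambda_3)$ if $\lambda_2+\lambda_3$ is even and $(\lambda_1-1,\lambda_2+1,\lambda_3)\notin E_{3,\lambda_1-1}$; $\varphi(\lambda)=(\lambda_1,\lambda_2+1,\lambda_3)$ if $\lambda_2+\lambda_3$ is odd and $(\lambda_1-1,\lambda_2,\lambda_3+1)\in E_{3,\lambda_1-1}$; $\varphi(\lambda)=(\lambda_1,\lambda_2,\lambda_3+1)$ if $\lambda_2+\lambda_3$ is odd and $(\lambda_1-1,\lambda_2,\lambda_3+1)\notin E_{3,\lambda_1-1}$. (These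 cases cover all of $L(3,n)\setminus E_{3,n}$, and $\varphi$ is a bijection onto $L(3,n)\setminus S_{3,n}$.) A chain decomposition is a partition of the poset into disjoint chains. *)

theory Defs
  imports Main "HOL-Library.Product_Order" "HOL-Library.Disjoint_Sets"
begin

text \<open>With \<^theory>\<open>HOL-Library.Product_Order\<close>, the order on triples is the
  componentwise one.\<close>

type_synonym triple = "int \<times> int \<times> int"

definition L3 :: "int \<Rightarrow> triple set" where
  "L3 n = {(a, b, c). n \<ge> a \<and> a \<ge> b \<and> b \<ge> c \<and> c \<ge> 0}"

definition covers_in :: "'a::order set \<Rightarrow> 'a \<Rightarrow> 'a \<Rightarrow> bool" where
  "covers_in A x y \<longleftrightarrow> x \<in> A \<and> y \<in> A \<and> x < y \<and> \<not> (\<exists>z\<in>A. x < z \<and> z < y)"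

definition chain_decomposition :: "'a::order set \<Rightarrow> 'a set set \<Rightarrow> bool" where
  "chain_decomposition A P \<longleftrightarrow>
     partition_on A P \<and> (\<forall>C\<in>P. Complete_Partial_Order.chain (\<le>) C)"

fun dual3 :: "int \<Rightarrow> triple \<Rightarrow> triple" where
  "dual3 n (a, b, c) = (n - c, n - b, n - a)"

definition S3 :: "int \<Rightarrow> triple set" where
  "S3 n = {(4 * int k + int l, 2 * int k, 0) | k l :: nat.
      l \<noteq> 1 \<and> 4 * int k + int l \<le> n \<and> 2 * (6 * int k + int l) \<le> 3 * n}"

text \<open>The index is an integer because the map below consults the set at index
  \<open>a - 1\<close>. The sets are empty at negative indices, and all their elements are
  partitions (the condition \<open>4 * k + l \<le> n\<close> forces both), so no separate
  convention for non-partitions is needed.\<close>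

definition E3 :: "int \<Rightarrow> triple set" where
  "E3 n = dual3 n ` S3 n"

text \<open>The value \<open>undefined\<close> is never taken on \<open>L3 n - E3 n\<close>.\<close>

fun phi :: "triple \<Rightarrow> triple" where
  "phi (a, b, c) =
     (if (a, b, c) \<in> E3 a then (a + 1, b, c)
      else if even (b + c) \<and> (a - 1, b + 1, c) \<notin> E3 (a - 1) then (a, b + 1, c)
      else if odd (b + c) \<and> (a - 1, b, c + 1) \<in> E3 (a - 1) then (a, b + 1, c)
      else if odd (b + c) \<and> (a - 1, b, c + 1) \<notin> E3 (a - 1) then (a, b, c + 1)
      else undefined)"

text \<open>As \<open>phi\<close> is only meant on \<open>L3 n - E3 n\<close>, iteration from \<open>\<mu>\<close> stops at the
  first element of \<open>E3 n\<close> that is met.\<close>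

definition chain_len :: "int \<Rightarrow> triple \<Rightarrow> nat" where
  "chain_len n \<mu> = (LEAST s. (phi ^^ s) \<mu> \<in> E3 n)"

definition chain_from :: "int \<Rightarrow> triple \<Rightarrow> triple set" where
  "chain_from n \<mu> = (\<lambda>i. (phi ^^ i) \<mu>) ` {..chain_len n \<mu>}"

fun add_first :: "triple \<Rightarrow> triple" where
  "add_first (a, b, c) = (a + 1, b, c)"

fun add_second :: "triple \<Rightarrow> triple" where
  "add_second (a, b, c) = (a, b + 1, c)"

fun add_third :: "triple \<Rightarrow> triple" where
  "add_third (a, b, c) = (a, b, c + 1)"

text \<open>In the following two definitions, the passage from \<open>(phi ^^ i) \<mu>\<close> to
  \<open>(phi ^^ Suc i) \<mu>\<close> is step number \<open>i + 1\<close>.\<close>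

definition type_I_chain :: "nat \<Rightarrow> nat \<Rightarrow> bool" where
  "type_I_chain n k \<longleftrightarrow>
     (let \<mu> = (4 * int k, 2 * int k, 0); s = chain_len (int n) \<mu> in
      s = 3 * n - 12 * k \<and>
      (\<forall>i<s. (phi ^^ Suc i) \<mu> =
         (if i mod 3 = 0 then add_first
          else if i mod 3 = 1 then add_second
          else add_third) ((phi ^^ i) \<mu>)) \<and>
      (phi ^^ s) \<mu> = (int n, int n - 2 * int k, int n - 4 * int k))"

definition type_II_chain :: "nat \<Rightarrow> nat \<Rightarrow> nat \<Rightarrow> bool" where
  "type_II_chain n k l \<longleftrightarrow>
     (let \<mu> = (4 * int k + int l, 2 * int k, 0); s = chain_len (int n) \<mu> in
      2 * l - 2 \<le> s \<and>
      (\<forall>i<2 * l - 4. (phi ^^ Suc i) \<mu> =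
         (if even i then add_second else add_third) ((phi ^^ i) \<mu>)) \<and>
      (phi ^^ (2 * l - 4)) \<mu> = (4 * int k + int l, 2 * int k + int l - 2, int l - 2) \<and>
      (\<forall>i\<in>{2 * l - 4, 2 * l - 3}. (phi ^^ Suc i) \<mu> = add_second ((phi ^^ i) \<mu>)) \<and>
      (phi ^^ (2 * l - 2)) \<mu> = (4 * int k + int l, 2 * int k + int l, int l - 2) \<and>
      (\<forall>i\<in>{2 * l - 2..<s}. (phi ^^ Suc i) \<mu> =
         (if even i then add_first else add_second) ((phi ^^ i) \<mu>)) \<and>
      (phi ^^ s) \<mu> = (int n, int n - 2 * int k, int l - 2))"

end

theory Submission
  imports Defs
begin

text \<open>The whole theorem follows from a closed form for the iterates of \<open>phi\<close>.
  Two observations make it accessible. First, \<open>(a, b, c) \<in> E3 n\<close> says that \<open>a = n\<close>,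
  \<open>0 \<le> c\<close>, \<open>a - b\<close> is even and nonnegative, and the defect \<open>d = 2 * b - a - c\<close> is nonnegative and
  not \<open>1\<close> (\<open>mem_E3_iff\<close>). Each case distinction in \<open>phi\<close>
  thereby becomes linear arithmetic with parities. Secondly, the bottom of a chain has the form
  \<open>(4 * k + l, 2 * k, 0)\<close> with \<open>l \<noteq> 1\<close>, and the point reached from there after \<open>i\<close> steps is an
  explicit triple \<open>orbit k l i\<close>. That \<open>phi\<close> advances this triple by one step (\<open>phi_orbit\<close>) is
  checked on the seven shapes that it can take.

  The shapes divide \<open>L3 n\<close> among themselves by the defect. On a type I chain (\<open>l = 0\<close>) the defect
  cycles through \<open>0, -1, 1\<close>, while \<open>a - b\<close> cycles through \<open>2 * k, 2 * k + 1, 2 * k\<close>.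
  On a type II chain the first part, in which \<open>a\<close> is constant, has defect
  at most \<open>-2\<close> when \<open>b - c = 2 * k\<close> and at most \<open>0\<close>
  when \<open>b - c = 2 * k + 1\<close>; the second
  part, in which \<open>c\<close> is constant, has defect at least \<open>2\<close> when \<open>a - b = 2 * k\<close> and at least \<open>1\<close>
  when \<open>a - b = 2 * k + 1\<close>. As \<open>d\<close> has the parity of \<open>a + c\<close>, these conditions exclude each other
  and exhaust all triples. Hence a triple determines \<open>(k, l)\<close> (\<open>chain_params_orbit\<close>), its rank
  \<open>a + b + c\<close> then determines \<open>i\<close>, and every triple of \<open>L3 n\<close> occurs
  (\<open>L3_covered_by_orbits\<close>). Moreover an orbit meets \<open>E3 n\<close> exactly once, at the step
  \<open>orbit_len n k l\<close> (\<open>orbit_mem_E3_iff\<close>).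

  So \<open>(\<mu>, i) \<mapsto> (phi ^^ i) \<mu>\<close> enumerates \<open>L3 n\<close> without repetition (\<open>tracing_L3\<close>). Such an
  enumeration yields, for purely set-theoretic reasons, both the bijectivity of \<open>phi\<close> and the
  partition into chains. The step rules for the two types are read off from the closed form.\<close>

section \<open>Chains traced out by iterating a map\<close>

text \<open>If every point of \<open>A\<close> is met exactly once along one of the iteration paths, then \<open>f\<close> moves
  each point to its successor on its path. The points without a successor are the ends of the
  paths, and those without a predecessor are the starts.\<close>

lemma bij_betw_of_tracing:
  assumes bij: "bij_betw (\<lambda>(m, i). (f ^^ i) m) (SIGMA m:S. {..len m}) A"
    and E: "E = (\<lambda>m. (f ^^ len m) m) ` S"
  shows "bij_betw f (A - E) (A - S)"
proof -
  have inj: "m = m' \<and> i = j" if "m \<in> S" "m' \<in> S" "i \<le> len m" "j \<le> len m'"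
    "(f ^^ i) m = (f ^^ j) m'" for m m' i j
    using inj_onD[OF bij_betw_imp_inj_on[OF bij], of "(m, i)" "(m', j)"] that by simp
  have surj: "\<exists>m i. m \<in> S \<and> i \<le> len m \<and> x = (f ^^ i) m" if "x \<in> A" for x
    using bij_betw_imp_surj_on[OF bij] that by force
  have mem: "(f ^^ i) m \<in> A" if "m \<in> S" "i \<le> len m" for m i
    using bij_betw_imp_surj_on[OF bij] that by force
  have domain: "\<exists>m i. m \<in> S \<and> i < len m \<and> x = (f ^^ i) m" if "x \<in> A - E" for x
  proof -
    obtain m i where m: "m \<in> S" "i \<le> len m" "x = (f ^^ i) m" using surj \<open>x \<in> A - E\<close> by blast
    then have "i \<noteq> len m" using that unfolding E by blast
    then show ?thesis using m by force
  qed
  show ?thesis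
    unfolding bij_betw_def
  proof
    show "inj_on f (A - E)"
    proof (rule inj_onI)
      fix x y assume xy: "x \<in> A - E" "y \<in> A - E" "f x = f y"
      obtain m i where x: "m \<in> S" "i < len m" "x = (f ^^ i) m" using domain[OF xy(1)] by blast
      obtain m' j where y: "m' \<in> S" "j < len m'" "y = (f ^^ j) m'" using domain[OF xy(2)] by blast
      show "x = y" using inj[of m m' "Suc i" "Suc j"] x y xy(3) by auto
    qed
    show "f ` (A - E) = A - S"
    proof
      show "f ` (A - E) \<subseteq> A - S"
      proof
        fix y assume "y \<in> f ` (A - E)"
        then obtain x where x: "x \<in> A - E" "y = f x" by blast
        then obtain m i where m: "m \<in> S" "i < len m" "x = (f ^^ i) m" using domain by blast
        have y: "y = (f ^^ Suc i) m" using x m by simp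
        have "y \<notin> S" using inj[of m y "Suc i" 0] m y by auto
        then show "y \<in> A - S" using mem[of m "Suc i"] m y by auto
      qed
      show "A - S \<subseteq> f ` (A - E)"
      proof
        fix y assume y: "y \<in> A - S"
        then obtain m i where m: "m \<in> S" "i \<le> len m" "y = (f ^^ i) m" using surj by blast
        with y obtain j where j: "i = Suc j" by (cases i) auto
        have "(f ^^ j) m \<noteq> (f ^^ len m') m'" if "m' \<in> S" for m'
          using inj[of m m' j "len m'"] m j that by auto
        then have "(f ^^ j) m \<notin> E" unfolding E by blast
        then show "y \<in> f ` (A - E)" using mem[of m j] m j by auto
      qed
    qed
  qed
qed

lemma partition_on_of_tracing:
  assumes bij: "bij_betw (\<lambda>(m, i). (f ^^ i) m) (SIGMA m:S. {..len m}) A"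
  shows "partition_on A ((\<lambda>m. (\<lambda>i. (f ^^ i) m) ` {..len m}) ` S)"
    and "inj_on (\<lambda>m. (\<lambda>i. (f ^^ i) m) ` {..len m}) S"
proof -
  have inj: "m = m'" if "m \<in> S" "m' \<in> S" "i \<le> len m" "j \<le> len m'"
    "(f ^^ i) m = (f ^^ j) m'" for m m' i j
    using inj_onD[OF bij_betw_imp_inj_on[OF bij], of "(m, i)" "(m', j)"] that by simp
  show "partition_on A ((\<lambda>m. (\<lambda>i. (f ^^ i) m) ` {..len m}) ` S)"
  proof (rule partition_onI)
    show "\<Union> ((\<lambda>m. (\<lambda>i. (f ^^ i) m) ` {..len m}) ` S) = A"
      using bij_betw_imp_surj_on[OF bij] by force
  next
    fix p q assume "p \<in> (\<lambda>m. (\<lambda>i. (f ^^ i) m) ` {..len m}) ` S" "q \<in> (\<lambda>m. (\<lambda>i. (f ^^ i) m) ` {..len m}) ` S"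
      and "p \<noteq> q"
    then obtain m m' where "m \<in> S" "m' \<in> S" "m \<noteq> m'"
      and p: "p = (\<lambda>i. (f ^^ i) m) ` {..len m}" and q: "q = (\<lambda>i. (f ^^ i) m') ` {..len m'}"
      by blast
    then have "(f ^^ i) m \<noteq> (f ^^ j) m'" if "i \<le> len m" "j \<le> len m'" for i j
      using inj that by blast
    then show "disjnt p q" unfolding p q disjnt_iff by blast
  qed auto
  show "inj_on (\<lambda>m. (\<lambda>i. (f ^^ i) m) ` {..len m}) S"
  proof (rule inj_onI)
    fix m m' assume m: "m \<in> S" "m' \<in> S"
      and eq: "(\<lambda>i. (f ^^ i) m) ` {..len m} = (\<lambda>i. (f ^^ i) m') ` {..len m'}"
    have "(f ^^ 0) m \<in> (\<lambda>i. (f ^^ i) m') ` {..len m'}" unfolding eq[symmetric] by blast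
    then show "m = m'" using inj[of m m' 0] m by auto
  qed
qed

section \<open>Bottoms and tops of the chains\<close>

text \<open>The bound on \<open>a = 4 * k + l\<close> gives \<open>2 * (6 * k + l) + l = 3 * a \<le> 3 * n\<close>, which contains the
  second inequality in the definition of \<open>S3\<close>.\<close>

lemma mem_S3_iff:
  "(a, b, c) \<in> S3 n \<longleftrightarrow> c = 0 \<and> even b \<and> 0 \<le> b \<and> 2 * b \<le> a \<and> a \<noteq> 2 * b + 1 \<and> a \<le> n"
    (is "?L \<longleftrightarrow> ?R")
proof
  assume ?R
  then have "(a, b, c) = (4 * int (nat (b div 2)) + int (nat (a - 2 * b)), 2 * int (nat (b div 2)), 0)"
    and "nat (a - 2 * b) \<noteq> 1"
    and "4 * int (nat (b div 2)) + int (nat (a - 2 * b)) \<le> n"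
    and "2 * (6 * int (nat (b div 2)) + int (nat (a - 2 * b))) \<le> 3 * n"
    by auto
  then show ?L unfolding S3_def by blast
qed (auto simp: S3_def)

text \<open>The dual of \<open>(n, b, c)\<close> is \<open>(n - c, n - b, 0)\<close>, so the conditions on an element of \<open>S3 n\<close>
  turn into conditions on \<open>n - b\<close> and on \<open>(n - c) - 2 * (n - b)\<close>. Apart from \<open>a = n\<close> they do not
  mention \<open>n\<close>, so the tests at the indices \<open>a\<close> and \<open>a - 1\<close> in \<open>phi\<close>, and the stopping test at the
  index \<open>n\<close>, are instances of one condition on triples.\<close>

lemma mem_E3_iff:
  "(a, b, c) \<in> E3 n \<longleftrightarrow>
     a = n \<and> even (a - b) \<and> b \<le> a \<and> 0 \<le> c \<and> a + c \<le> 2 * b \<and> 2 * b \<noteq> a + c + 1"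
proof -
  have "(a, b, c) \<in> E3 n \<longleftrightarrow> dual3 n (a, b, c) \<in> S3 n"
  proof
    assume "dual3 n (a, b, c) \<in> S3 n"
    then show "(a, b, c) \<in> E3 n" unfolding E3_def by (rule rev_image_eqI) simp
  qed (auto simp: E3_def)
  then show ?thesis by (auto simp: mem_S3_iff)
qed

lemma mem_S3E:
  assumes "m \<in> S3 n"
  obtains k l where "m = (4 * k + l, 2 * k, 0)" "0 \<le> k" "0 \<le> l" "l \<noteq> 1" "4 * k + l \<le> n"
proof -
  from assms obtain k l :: nat where "m = (4 * int k + int l, 2 * int k, 0)" "l \<noteq> 1" "4 * int k + int l \<le> n"
    by (auto simp: S3_def)
  then show thesis using that[of "int k" "int l"] by simp
qed

section \<open>Explicit orbits\<close>

text \<open>The point \<open>i\<close> steps above \<open>(4 * k + l, 2 * k, 0)\<close>. For \<open>l \<ge> 2\<close> the second entry grows in the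
  odd-numbered steps up to \<open>2 * l - 3\<close> and in the even-numbered steps from \<open>2 * l - 2\<close> on, which puts
  its two consecutive increments just before the change of formula.\<close>

definition orbit :: "int \<Rightarrow> int \<Rightarrow> int \<Rightarrow> triple" where
  "orbit k l i =
     (if l = 0 then (4 * k + (i + 2) div 3, 2 * k + (i + 1) div 3, i div 3)
      else if i < 2 * l - 2 then (4 * k + l, 2 * k + (i + 1) div 2, i div 2)
      else (4 * k + (i + 3) div 2, 2 * k + (i + 2) div 2, l - 2))"

text \<open>The rank of \<open>(n, n - 2 * k, n - 4 * k)\<close>, respectively of \<open>(n, n - 2 * k, l - 2)\<close>, minus the rank
  \<open>6 * k + l\<close> of the starting point.\<close>

definition orbit_len :: "int \<Rightarrow> int \<Rightarrow> int \<Rightarrow> int" where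
  "orbit_len n k l = (if l = 0 then 3 * n - 12 * k else 2 * n - 8 * k - 2)"

text \<open>The seven shapes of a point on an orbit. In the lower part of a type II orbit the first entry
  is constant, in the upper part the third one.\<close>

lemma orbit_cases:
  fixes l i :: int
  assumes "0 \<le> l" "l \<noteq> 1" "0 \<le> i"
  obtains (cyclic0) q where "0 \<le> q" "l = 0" "i = 3 * q"
    | (cyclic1) q where "0 \<le> q" "l = 0" "i = 3 * q + 1"
    | (cyclic2) q where "0 \<le> q" "l = 0" "i = 3 * q + 2"
    | (lower0) q where "0 \<le> q" "q + 2 \<le> l" "i = 2 * q"
    | (lower1) q where "0 \<le> q" "q + 2 \<le> l" "i = 2 * q + 1"
    | (upper0) q where "2 \<le> l" "l - 1 \<le> q" "i = 2 * q"
    | (upper1) q where "2 \<le> l" "l - 1 \<le> q" "i = 2 * q + 1"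
proof (cases "l = 0")
  case True
  have "i = 3 * (i div 3) + i mod 3" "0 \<le> i div 3" using assms by simp_all
  moreover have "i mod 3 = 0 \<or> i mod 3 = 1 \<or> i mod 3 = 2" by presburger
  ultimately show thesis using that(1-3) True by (metis add.right_neutral)
next
  case False
  define q where "q = i div 2"
  have q: "0 \<le> q" "i = 2 * q \<or> i = 2 * q + 1" using assms unfolding q_def by auto
  show thesis
  proof (cases "q < l - 1")
    case True
    then show thesis using that(4,5)[of q] q by auto
  next
    assume "\<not> q < l - 1"
    then show thesis using that(6,7)[of q] q False assms by auto
  qed
qed

lemma orbit_forms:
  "orbit k 0 (3 * q) = (4 * k + q, 2 * k + q, q)"
  "orbit k 0 (3 * q + 1) = (4 * k + q + 1, 2 * k + q, q)"
  "orbit k 0 (3 * q + 2) = (4 * k + q + 1, 2 * k + q + 1, q)"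
  "0 \<le> q \<Longrightarrow> q + 2 \<le> l \<Longrightarrow> orbit k l (2 * q) = (4 * k + l, 2 * k + q, q)"
  "0 \<le> q \<Longrightarrow> q + 2 \<le> l \<Longrightarrow> orbit k l (2 * q + 1) = (4 * k + l, 2 * k + q + 1, q)"
  "2 \<le> l \<Longrightarrow> l - 1 \<le> q \<Longrightarrow> orbit k l (2 * q) = (4 * k + q + 1, 2 * k + q + 1, l - 2)"
  "2 \<le> l \<Longrightarrow> l - 1 \<le> q \<Longrightarrow> orbit k l (2 * q + 1) = (4 * k + q + 2, 2 * k + q + 1, l - 2)"
  by (auto simp: orbit_def)

text \<open>The parity of \<open>a - b\<close> refutes most of the memberships that \<open>phi\<close> tests; the value of the
  defect settles the others.\<close>

lemma phi_orbit:
  assumes "0 \<le> k" "0 \<le> l" "l \<noteq> 1" "0 \<le> i"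
  shows "phi (orbit k l i) = orbit k l (i + 1)"
  using assms(2-4)
proof (cases rule: orbit_cases)
  case (cyclic0 q)
  then show ?thesis using assms by (simp add: orbit_forms mem_E3_iff)
next
  case (cyclic1 q)
  then show ?thesis using assms by (simp add: orbit_forms mem_E3_iff add.assoc)
next
  case (cyclic2 q)
  then show ?thesis using assms orbit_forms(1)[of k "q + 1"]
    by (simp add: orbit_forms mem_E3_iff add.assoc)
next
  case (lower0 q)
  \<comment> \<open>The triple \<open>(a - 1, b + 1, c)\<close> has defect \<open>q - l + 3\<close>. If its first two entries have the
    same parity, as \<open>E3\<close> requires, that defect is either the forbidden value \<open>1\<close> or negative.\<close>
  have "l = q + 2 \<or> q + 4 \<le> l" if "even l = even q" using lower0(2) that by presburger
  then show ?thesis using lower0 assms by (auto simp: orbit_forms mem_E3_iff)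
next
  case (lower1 q)
  \<comment> \<open>For \<open>l = q + 2\<close> this is the turning point: \<open>(a - 1, b, c + 1)\<close> has defect \<open>0\<close> and lies in
    \<open>E3 (a - 1)\<close>, so the second entry is raised once more. For larger \<open>l\<close> its defect is negative.\<close>
  have next_point: "orbit k l (i + 1) =
    (if l = q + 2 then (4 * k + l, 2 * k + q + 2, q) else (4 * k + l, 2 * k + q + 1, q + 1))"
    using lower1 orbit_forms(6)[of l "q + 1" k] orbit_forms(4)[of "q + 1" l k]
    by (auto simp: algebra_simps)
  show ?thesis
  proof (cases "l = q + 2")
    case True
    then show ?thesis using assms lower1 unfolding next_point by (simp add: orbit_forms mem_E3_iff)
  next
    case False
    then show ?thesis using assms lower1 unfolding next_point by (auto simp: orbit_forms mem_E3_iff)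
  qed
next
  case (upper0 q)
  then show ?thesis using assms by (simp add: orbit_forms mem_E3_iff)
next
  case (upper1 q)
  have "orbit k l (i + 1) = (4 * k + q + 2, 2 * k + q + 2, l - 2)"
    using upper1 orbit_forms(6)[of l "q + 1" k] by (simp add: algebra_simps)
  moreover have "even q = odd l" if "q + 1 = l" using that by auto
  ultimately show ?thesis using upper1 assms by (auto simp: orbit_forms mem_E3_iff)
qed

lemma orbit_0: "0 \<le> l \<Longrightarrow> l \<noteq> 1 \<Longrightarrow> orbit k l 0 = (4 * k + l, 2 * k, 0)"
  by (auto simp: orbit_def)

lemma funpow_phi_eq_orbit:
  assumes "0 \<le> k" "0 \<le> l" "l \<noteq> 1"
  shows "(phi ^^ i) (4 * k + l, 2 * k, 0) = orbit k l (int i)"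
proof (induction i)
  case 0
  then show ?case using assms by (simp add: orbit_0)
next
  case (Suc i)
  then show ?case using phi_orbit[OF assms, of "int i"] by (simp add: add.commute)
qed

lemma orbit_mem_L3:
  assumes "0 \<le> k" "0 \<le> l" "l \<noteq> 1" "4 * k + l \<le> n" "0 \<le> i" "i \<le> orbit_len n k l"
  shows "orbit k l i \<in> L3 n"
  using assms(2,3,5)
  by (cases rule: orbit_cases)
    (use assms in \<open>auto simp: orbit_forms L3_def orbit_len_def\<close>)

text \<open>The lower part of an orbit never meets \<open>E3 n\<close>, because there the defect is negative or
  \<open>a - b\<close> is odd. On a type I orbit the points of defect \<open>0\<close>, and on the upper part of a type II
  orbit the points with even \<open>a - b\<close>, satisfy all conditions except possibly \<open>a = n\<close>, and no other
  points do. Their first entries run through the integers from \<open>4 * k + l\<close> upwards, each once, so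
  exactly one of them has \<open>a = n\<close>.\<close>

lemma orbit_mem_E3_iff:
  assumes "0 \<le> k" "0 \<le> l" "l \<noteq> 1" "4 * k + l \<le> n" "0 \<le> i"
  shows "orbit k l i \<in> E3 n \<longleftrightarrow> i = orbit_len n k l"
  using assms(2,3,5)
  by (cases rule: orbit_cases;
      use assms in \<open>auto simp: orbit_forms mem_E3_iff orbit_len_def; presburger\<close>)

text \<open>The parameters \<open>(k, l)\<close> of the orbit through a triple. The three branches recognise the lower part
  of a type II orbit, its upper part, and a type I orbit. In the first, \<open>b - c\<close> is \<open>2 * k\<close> or
  \<open>2 * k + 1\<close> and \<open>a = 4 * k + l\<close>; in the other two, \<open>a - b\<close> is \<open>2 * k\<close> or \<open>2 * k + 1\<close>, and the upper
  part has \<open>c = l - 2\<close>.\<close>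

fun chain_params :: "triple \<Rightarrow> int \<times> int" where
  "chain_params (a, b, c) =
     (if 2 * b - a - c \<le> -2 \<or> 2 * b - a - c \<le> 0 \<and> odd (b - c)
        then ((b - c) div 2, a - 4 * ((b - c) div 2))
      else if 2 * b - a - c \<ge> 2 \<or> 2 * b - a - c \<ge> 1 \<and> odd (a - b)
        then ((a - b) div 2, c + 2)
      else ((a - b) div 2, 0))"

lemma chain_params_orbit:
  assumes "0 \<le> k" "0 \<le> l" "l \<noteq> 1" "0 \<le> i"
  shows "chain_params (orbit k l i) = (k, l)"
  using assms(2-4)
  by (cases rule: orbit_cases)
    (use assms in \<open>auto simp: orbit_forms\<close>)

fun rank3 :: "triple \<Rightarrow> int" where
  "rank3 (a, b, c) = a + b + c"

lemma rank3_orbit: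
  assumes "0 \<le> k" "0 \<le> l" "l \<noteq> 1" "0 \<le> i"
  shows "rank3 (orbit k l i) = 6 * k + l + i"
  using assms(2-4)
  by (cases rule: orbit_cases) (use assms in \<open>auto simp: orbit_forms\<close>)

text \<open>The defect and the parities of \<open>b - c\<close> and \<open>a - b\<close> tell which of the seven shapes a
  triple has; its step number is then found by solving the formulas in \<open>orbit_forms\<close> for \<open>i\<close>. The
  inequalities defining \<open>L3 n\<close> supply the bounds on the parameters and on \<open>i\<close>.\<close>

lemma L3_covered_by_orbits:
  assumes "x \<in> L3 n"
  obtains k l i where "0 \<le> k" "0 \<le> l" "l \<noteq> 1" "4 * k + l \<le> n"
    "0 \<le> i" "i \<le> orbit_len n k l" "x = orbit k l i"
proof -
  obtain a b c where x: "x = (a, b, c)" by (cases x)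
  with assms have L: "a \<le> n" "b \<le> a" "c \<le> b" "0 \<le> c" by (auto simp: L3_def)
  consider (lower0) "2 * b \<le> a + c - 2" "even (b - c)"
    | (lower1) "2 * b \<le> a + c" "odd (b - c)"
    | (upper0) "a + c + 2 \<le> 2 * b" "even (a - b)"
    | (upper1) "a + c + 1 \<le> 2 * b" "odd (a - b)"
    | (cyclic0) "2 * b = a + c" "even (a - b)"
    | (cyclic1) "2 * b = a + c - 1" "odd (a - b)"
    | (cyclic2) "2 * b = a + c + 1" "even (a - b)"
  proof -
    \<comment> \<open>Since \<open>a - b\<close> and \<open>b - c\<close> have the same parity exactly if \<open>a + c\<close> is even, the parity
      of \<open>b - c\<close> fixes that of \<open>a - b\<close> once the defect is known. This settles the defects \<open>0\<close> and \<open>-1\<close>.\<close>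
    have "2 * b \<le> a + c - 2 \<and> even (b - c) \<or> 2 * b \<le> a + c \<and> odd (b - c) \<or>
      a + c + 2 \<le> 2 * b \<and> even (a - b) \<or> a + c + 1 \<le> 2 * b \<and> odd (a - b) \<or>
      2 * b = a + c \<and> even (a - b) \<or> 2 * b = a + c - 1 \<and> odd (a - b) \<or>
      2 * b = a + c + 1 \<and> even (a - b)" by presburger
    then show thesis using that by blast
  qed
  then show thesis
  proof cases
    case lower0
    from lower0(2) obtain k where k: "b - c = 2 * k" by (elim evenE)
    show thesis
      by (rule that[of k "a - 4 * k" "2 * c"])
        (use orbit_forms(4)[of c "a - 4 * k" k] x L lower0(1) k in \<open>auto simp: orbit_len_def\<close>)
  next
    case lower1
    from lower1(2) obtain k where k: "b - c = 2 * k + 1" by (elim oddE)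
    show thesis
      by (rule that[of k "a - 4 * k" "2 * c + 1"])
        (use orbit_forms(5)[of c "a - 4 * k" k] x L lower1(1) k in \<open>auto simp: orbit_len_def\<close>)
  next
    case upper0
    from upper0(2) obtain k where k: "a - b = 2 * k" by (elim evenE)
    show thesis
      by (rule that[of k "c + 2" "2 * (2 * b - a - 1)"])
        (use orbit_forms(6)[of "c + 2" "2 * b - a - 1" k] x L upper0(1) k in \<open>auto simp: orbit_len_def\<close>)
  next
    case upper1
    from upper1(2) obtain k where k: "a - b = 2 * k + 1" by (elim oddE)
    show thesis
      by (rule that[of k "c + 2" "2 * (2 * b - a) + 1"])
        (use orbit_forms(7)[of "c + 2" "2 * b - a" k] x L upper1(1) k in \<open>auto simp: orbit_len_def\<close>)
  next
    case cyclic0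
    from cyclic0(2) obtain k where k: "a - b = 2 * k" by (elim evenE)
    show thesis
      by (rule that[of k 0 "3 * c"])
        (use orbit_forms(1)[of k c] x L cyclic0(1) k in \<open>auto simp: orbit_len_def\<close>)
  next
    case cyclic1
    from cyclic1(2) obtain k where k: "a - b = 2 * k + 1" by (elim oddE)
    show thesis
      by (rule that[of k 0 "3 * c + 1"])
        (use orbit_forms(2)[of k c] x L cyclic1(1) k in \<open>auto simp: orbit_len_def\<close>)
  next
    case cyclic2
    from cyclic2(2) obtain k where k: "a - b = 2 * k" by (elim evenE)
    show thesis
      by (rule that[of k 0 "3 * c + 2"])
        (use orbit_forms(3)[of k c] x L cyclic2(1) k in \<open>auto simp: orbit_len_def\<close>)
  qed
qed

section \<open>The chains of the poset\<close>

lemma orbit_len_nonneg: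
  "0 \<le> k \<Longrightarrow> 0 \<le> l \<Longrightarrow> l \<noteq> 1 \<Longrightarrow> 4 * k + l \<le> n \<Longrightarrow> 0 \<le> orbit_len n k l"
  by (auto simp: orbit_len_def)

lemma chain_len_eq:
  assumes "0 \<le> k" "0 \<le> l" "l \<noteq> 1" "4 * k + l \<le> n"
  shows "int (chain_len n (4 * k + l, 2 * k, 0)) = orbit_len n k l"
proof -
  have "chain_len n (4 * k + l, 2 * k, 0) = (LEAST s. int s = orbit_len n k l)"
    unfolding chain_len_def funpow_phi_eq_orbit[OF assms(1-3)]
    using orbit_mem_E3_iff[OF assms] by simp
  also have "int \<dots> = orbit_len n k l"
    using LeastI[of "\<lambda>s. int s = orbit_len n k l" "nat (orbit_len n k l)"] orbit_len_nonneg[OF assms]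
    by simp
  finally show ?thesis .
qed

lemma tracing_L3:
  "bij_betw (\<lambda>(m, i). (phi ^^ i) m) (SIGMA m:S3 n. {..chain_len n m}) (L3 n)"
  unfolding bij_betw_def
proof
  show "inj_on (\<lambda>(m, i). (phi ^^ i) m) (SIGMA m:S3 n. {..chain_len n m})"
  proof (rule inj_onI)
    fix p p' assume "p \<in> (SIGMA m:S3 n. {..chain_len n m})" "p' \<in> (SIGMA m:S3 n. {..chain_len n m})"
      and "(\<lambda>(m, i). (phi ^^ i) m) p = (\<lambda>(m, i). (phi ^^ i) m) p'"
    then obtain m i m' j where p: "p = (m, i)" "p' = (m', j)" and "m \<in> S3 n" "m' \<in> S3 n"
      and eq: "(phi ^^ i) m = (phi ^^ j) m'" by (elim SigmaE) simp
    from this(3) obtain k l where m: "m = (4 * k + l, 2 * k, 0)" "0 \<le> k" "0 \<le> l" "l \<noteq> 1"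
      by (rule mem_S3E)
    from \<open>m' \<in> S3 n\<close> obtain k' l' where
      m': "m' = (4 * k' + l', 2 * k', 0)" "0 \<le> k'" "0 \<le> l'" "l' \<noteq> 1" by (rule mem_S3E)
    have eq': "orbit k l (int i) = orbit k' l' (int j)"
      using eq m m' by (simp add: funpow_phi_eq_orbit)
    have "k = k'" "l = l'"
      using chain_params_orbit[OF m(2-4), of "int i"] chain_params_orbit[OF m'(2-4), of "int j"] eq'
      by simp_all
    moreover have "6 * k + l + int i = 6 * k' + l' + int j"
      using rank3_orbit[OF m(2-4), of "int i"] rank3_orbit[OF m'(2-4), of "int j"]
      unfolding eq' by simp
    ultimately show "p = p'" using p m(1) m'(1) by simp
  qed
  show "(\<lambda>(m, i). (phi ^^ i) m) ` (SIGMA m:S3 n. {..chain_len n m}) = L3 n"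
  proof
    show "(\<lambda>(m, i). (phi ^^ i) m) ` (SIGMA m:S3 n. {..chain_len n m}) \<subseteq> L3 n"
    proof
      fix x assume "x \<in> (\<lambda>(m, i). (phi ^^ i) m) ` (SIGMA m:S3 n. {..chain_len n m})"
      then obtain m i where m: "m \<in> S3 n" and i: "i \<le> chain_len n m" and x: "x = (phi ^^ i) m"
        by (elim imageE SigmaE) simp
      from m obtain k l where kl: "m = (4 * k + l, 2 * k, 0)" "0 \<le> k" "0 \<le> l" "l \<noteq> 1" "4 * k + l \<le> n"
        by (rule mem_S3E)
      show "x \<in> L3 n"
        using orbit_mem_L3[OF kl(2-5), of "int i"] i chain_len_eq[OF kl(2-5)]
        unfolding x kl(1) funpow_phi_eq_orbit[OF kl(2-4)] by simp
    qed
    show "L3 n \<subseteq> (\<lambda>(m, i). (phi ^^ i) m) ` (SIGMA m:S3 n. {..chain_len n m})"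
    proof
      fix x assume "x \<in> L3 n"
      then obtain k l i where kl: "0 \<le> k" "0 \<le> l" "l \<noteq> 1" "4 * k + l \<le> n"
        and i: "0 \<le> i" "i \<le> orbit_len n k l" "x = orbit k l i" by (rule L3_covered_by_orbits)
      have "(4 * k + l, 2 * k, 0) \<in> S3 n" using kl by (simp add: mem_S3_iff)
      moreover have "nat i \<le> chain_len n (4 * k + l, 2 * k, 0)"
        using chain_len_eq[OF kl] i by simp
      moreover have "x = (phi ^^ nat i) (4 * k + l, 2 * k, 0)"
        using i by (simp add: funpow_phi_eq_orbit[OF kl(1-3)])
      ultimately show "x \<in> (\<lambda>(m, i). (phi ^^ i) m) ` (SIGMA m:S3 n. {..chain_len n m})"
        by (intro image_eqI[where x = "((4 * k + l, 2 * k, 0), nat i)"]) simp_all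
    qed
  qed
qed

lemma chain_end_mem_E3:
  assumes "m \<in> S3 n"
  shows "(phi ^^ chain_len n m) m \<in> E3 n"
proof -
  from assms obtain k l where kl: "m = (4 * k + l, 2 * k, 0)" "0 \<le> k" "0 \<le> l" "l \<noteq> 1" "4 * k + l \<le> n"
    by (rule mem_S3E)
  show ?thesis
    unfolding kl(1) funpow_phi_eq_orbit[OF kl(2-4)]
    using orbit_mem_E3_iff[OF kl(2-5)] chain_len_eq[OF kl(2-5)] by simp
qed

lemma E3_eq_chain_ends: "E3 n = (\<lambda>m. (phi ^^ chain_len n m) m) ` S3 n"
proof
  show "E3 n \<subseteq> (\<lambda>m. (phi ^^ chain_len n m) m) ` S3 n"
  proof
    fix x assume x: "x \<in> E3 n"
    then have "x \<in> L3 n" by (cases x) (auto simp: mem_E3_iff L3_def)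
    then obtain k l i where kl: "0 \<le> k" "0 \<le> l" "l \<noteq> 1" "4 * k + l \<le> n"
      and i: "0 \<le> i" "x = orbit k l i" by (rule L3_covered_by_orbits)
    have "i = int (chain_len n (4 * k + l, 2 * k, 0))"
      using orbit_mem_E3_iff[OF kl i(1)] x i(2) chain_len_eq[OF kl] by simp
    then have "x = (phi ^^ chain_len n (4 * k + l, 2 * k, 0)) (4 * k + l, 2 * k, 0)"
      using i(2) funpow_phi_eq_orbit[OF kl(1-3)] by simp
    moreover have "(4 * k + l, 2 * k, 0) \<in> S3 n" using kl by (simp add: mem_S3_iff)
    ultimately show "x \<in> (\<lambda>m. (phi ^^ chain_len n m) m) ` S3 n" by (rule image_eqI)
  qed
qed (use chain_end_mem_E3 in blast)

lemma rank3_strict_mono: "x < y \<Longrightarrow> rank3 x < rank3 y"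
  by (cases x; cases y) (auto simp: less_le)

lemma covers_in_if_rank3_Suc:
  assumes "x \<in> A" "y \<in> A" "x \<le> y" "rank3 y = rank3 x + 1"
  shows "covers_in A x y"
proof -
  have "\<not> (x < z \<and> z < y)" for z
    using rank3_strict_mono[of x z] rank3_strict_mono[of z y] assms(4) by linarith
  moreover have "x < y" using assms(3,4) by (auto simp: less_le)
  ultimately show ?thesis using assms(1,2) unfolding covers_in_def by blast
qed

lemma orbit_mono:
  assumes "i \<le> j"
  shows "orbit k l i \<le> orbit k l j"
  using assms unfolding orbit_def
  by (auto simp: zdiv_mono1)

lemma orbit_add_cyclic:
  "orbit k 0 (i + 1) =
     (if i mod 3 = 0 then add_first else if i mod 3 = 1 then add_second else add_third) (orbit k 0 i)"
proof -
  consider q where "i = 3 * q" | q where "i = 3 * q + 1" | q where "i = 3 * q + 2"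
  proof -
    have "i = 3 * (i div 3) \<or> i = 3 * (i div 3) + 1 \<or> i = 3 * (i div 3) + 2" by presburger
    then show thesis using that by blast
  qed
  then show ?thesis
  proof cases
    case (1 q)
    then show ?thesis by (simp add: orbit_forms)
  next
    case (2 q)
    then show ?thesis by (simp add: orbit_forms add.assoc)
  next
    case (3 q)
    then show ?thesis using orbit_forms(1)[of k "q + 1"] by (simp add: orbit_forms add.assoc)
  qed
qed

lemma orbit_add_lower:
  assumes "0 \<le> i" "i < 2 * l - 4"
  shows "orbit k l (i + 1) = (if even i then add_second else add_third) (orbit k l i)"
proof (cases "even i")
  case True
  then obtain q where q: "i = 2 * q" by (elim evenE)
  show ?thesis
    using orbit_forms(4)[of q l k] orbit_forms(5)[of q l k] assms unfolding q by simp
next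
  case False
  then obtain q where q: "i = 2 * q + 1" by (elim oddE)
  have "2 * q + 1 + 1 = 2 * (q + 1)" by simp
  then have "orbit k l (i + 1) = orbit k l (2 * (q + 1))" by (simp only: q)
  then show ?thesis
    using orbit_forms(5)[of q l k] orbit_forms(4)[of "q + 1" l k] assms q by auto
qed

lemma orbit_add_turn:
  assumes "2 \<le> l" "i = 2 * l - 4 \<or> i = 2 * l - 3"
  shows "orbit k l (i + 1) = add_second (orbit k l i)"
  using assms by (auto simp: orbit_def)

lemma orbit_add_upper:
  assumes "2 \<le> l" "2 * l - 2 \<le> i"
  shows "orbit k l (i + 1) = (if even i then add_first else add_second) (orbit k l i)"
proof (cases "even i")
  case True
  then obtain q where q: "i = 2 * q" by (elim evenE)
  show ?thesis
    using orbit_forms(6)[of l q k] orbit_forms(7)[of l q k] assms unfolding q by simp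
next
  case False
  then obtain q where q: "i = 2 * q + 1" by (elim oddE)
  have "2 * q + 1 + 1 = 2 * (q + 1)" by simp
  then have "orbit k l (i + 1) = orbit k l (2 * (q + 1))" by (simp only: q)
  then show ?thesis
    using orbit_forms(7)[of l q k] orbit_forms(6)[of l "q + 1" k] assms q by auto
qed

lemma type_I_chain_if:
  assumes "k \<le> n div 4"
  shows "type_I_chain n k"
proof -
  have kn: "4 * k \<le> n" using assms by linarith
  have phi: "(phi ^^ i) (4 * int k, 2 * int k, 0) = orbit (int k) 0 (int i)" for i
    using funpow_phi_eq_orbit[of "int k" 0] by simp
  have "int (chain_len (int n) (4 * int k, 2 * int k, 0)) = 3 * int n - 12 * int k"
    using chain_len_eq[of "int k" 0 "int n"] kn by (simp add: orbit_len_def)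
  then have len: "chain_len (int n) (4 * int k, 2 * int k, 0) = 3 * n - 12 * k"
    using kn by linarith
  have step: "orbit (int k) 0 (int (Suc i)) =
    (if i mod 3 = 0 then add_first else if i mod 3 = 1 then add_second else add_third)
      (orbit (int k) 0 (int i))" for i
  proof -
    have "(int i mod 3 = 0) = (i mod 3 = 0)" "(int i mod 3 = 1) = (i mod 3 = 1)" by presburger+
    then show ?thesis using orbit_add_cyclic[of "int k" "int i"] by (simp only: of_nat_Suc add.commute)
  qed
  have "orbit (int k) 0 (int (3 * n - 12 * k)) = (int n, int n - 2 * int k, int n - 4 * int k)"
    using orbit_forms(1)[of "int k" "int (n - 4 * k)"] kn by (simp add: of_nat_diff right_diff_distrib)
  then show ?thesis
    unfolding type_I_chain_def Let_def len phi using step by blast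
qed

lemma type_II_chain_if:
  assumes "2 \<le> l" "l \<le> n" "k \<le> (n - l) div 4"
  shows "type_II_chain n k l"
proof -
  have kn: "4 * k + l \<le> n" using assms by linarith
  have phi: "(phi ^^ i) (4 * int k + int l, 2 * int k, 0) = orbit (int k) (int l) (int i)" for i
    using funpow_phi_eq_orbit[of "int k" "int l"] assms by simp
  have "int (chain_len (int n) (4 * int k + int l, 2 * int k, 0)) = 2 * int n - 8 * int k - 2"
    using chain_len_eq[of "int k" "int l" "int n"] kn assms by (simp add: orbit_len_def)
  then have len: "chain_len (int n) (4 * int k + int l, 2 * int k, 0) = 2 * n - 8 * k - 2"
    using kn by linarith
  have Suc: "int (Suc i) = int i + 1" for i by simp
  have diff: "int (2 * l - 4) = 2 * int l - 4" "int (2 * l - 3) = 2 * int l - 3"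
    "int (2 * l - 2) = 2 * int l - 2" "int (2 * n - 8 * k - 2) = 2 * int n - 8 * int k - 2"
    using assms kn by linarith+
  have even: "even (int i) = even i" for i by simp
  show ?thesis
    unfolding type_II_chain_def Let_def len phi
  proof (intro conjI allI impI ballI)
    show "2 * l - 2 \<le> 2 * n - 8 * k - 2" using kn by linarith
  next
    fix i assume "i < 2 * l - 4"
    then show "orbit (int k) (int l) (int (Suc i)) =
      (if even i then add_second else add_third) (orbit (int k) (int l) (int i))"
      using orbit_add_lower[of "int i" "int l" "int k"] assms unfolding Suc even by simp
  next
    show "orbit (int k) (int l) (int (2 * l - 4)) =
      (4 * int k + int l, 2 * int k + int l - 2, int l - 2)"
      unfolding diff using assms by (auto simp: orbit_def)
  next
    fix i assume "i \<in> {2 * l - 4, 2 * l - 3}"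
    then show "orbit (int k) (int l) (int (Suc i)) = add_second (orbit (int k) (int l) (int i))"
      using orbit_add_turn[of "int l" "int i" "int k"] assms diff unfolding Suc by auto
  next
    show "orbit (int k) (int l) (int (2 * l - 2)) =
      (4 * int k + int l, 2 * int k + int l, int l - 2)"
      unfolding diff using assms by (auto simp: orbit_def)
  next
    fix i assume i: "i \<in> {2 * l - 2..<2 * n - 8 * k - 2}"
    have "2 * int l - 2 \<le> int i" using i by simp linarith
    then show "orbit (int k) (int l) (int (Suc i)) =
      (if even i then add_first else add_second) (orbit (int k) (int l) (int i))"
      using orbit_add_upper[of "int l" "int i" "int k"] assms unfolding Suc even by simp
  next
    show "orbit (int k) (int l) (int (2 * n - 8 * k - 2)) = (int n, int n - 2 * int k, int l - 2)"
      unfolding diff using assms kn by (auto simp: orbit_def)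
  qed
qed

lemma S3_eq_bottoms:
  "S3 (int n) =
     {(4 * int k, 2 * int k, 0) | k :: nat. k \<le> n div 4} \<union>
     {(4 * int k + int l, 2 * int k, 0) | k l :: nat.
         2 \<le> l \<and> l \<le> n \<and> k \<le> (n - l) div 4}" (is "_ = ?I \<union> ?II")
proof
  show "S3 (int n) \<subseteq> ?I \<union> ?II"
  proof
    fix m assume "m \<in> S3 (int n)"
    then obtain k l :: nat where m: "m = (4 * int k + int l, 2 * int k, 0)" "l \<noteq> 1"
      "4 * int k + int l \<le> int n" by (auto simp: S3_def)
    show "m \<in> ?I \<union> ?II"
    proof (cases "l = 0")
      case True
      then have "m = (4 * int k, 2 * int k, 0)" "k \<le> n div 4" using m by auto
      then show ?thesis by blast
    next
      case False
      then have "2 \<le> l" "l \<le> n" "k \<le> (n - l) div 4" using m by auto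
      then show ?thesis using m(1) by blast
    qed
  qed
  show "?I \<union> ?II \<subseteq> S3 (int n)" by (auto simp: mem_S3_iff)
qed

lemma chain_from_is_chain:
  assumes "m \<in> S3 n"
  shows "Complete_Partial_Order.chain (\<le>) (chain_from n m)"
proof -
  from assms obtain k l where kl: "m = (4 * k + l, 2 * k, 0)" "0 \<le> k" "0 \<le> l" "l \<noteq> 1"
    by (rule mem_S3E)
  show ?thesis
    unfolding chain_from_def chain_def kl(1) funpow_phi_eq_orbit[OF kl(2-4)]
  proof (intro ballI, elim imageE)
    fix x y i j assume "x = orbit k l (int i)" "y = orbit k l (int j)"
    then show "x \<le> y \<or> y \<le> x"
      using orbit_mono[of "int i" "int j" k l] orbit_mono[of "int j" "int i" k l] linear[of "int i" "int j"] by metis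
  qed
qed

theorem theorem11:
  fixes n :: nat
  assumes "n \<ge> 1"
  shows "bij_betw phi (L3 (int n) - E3 (int n)) (L3 (int n) - S3 (int n))
    \<and> chain_decomposition (L3 (int n)) (chain_from (int n) ` S3 (int n))
    \<and> inj_on (chain_from (int n)) (S3 (int n))
    \<and> (\<forall>\<mu>\<in>S3 (int n).
          (\<forall>i<chain_len (int n) \<mu>.
             covers_in (L3 (int n)) ((phi ^^ i) \<mu>) ((phi ^^ Suc i) \<mu>)) \<and>
          (phi ^^ chain_len (int n) \<mu>) \<mu> \<in> E3 (int n))
    \<and> S3 (int n) =
        {(4 * int k, 2 * int k, 0) | k :: nat. k \<le> n div 4} \<union>
        {(4 * int k + int l, 2 * int k, 0) | k l :: nat.
            2 \<le> l \<and> l \<le> n \<and> k \<le> (n - l) div 4}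
    \<and> (\<forall>k\<le>n div 4. type_I_chain n k)
    \<and> (\<forall>l k. 2 \<le> l \<and> l \<le> n \<and> k \<le> (n - l) div 4 \<longrightarrow> type_II_chain n k l)"
proof (intro conjI ballI allI impI)
  have chain_from: "chain_from (int n) = (\<lambda>m. (\<lambda>i. (phi ^^ i) m) ` {..chain_len (int n) m})"
    by (simp add: chain_from_def fun_eq_iff)
  show "bij_betw phi (L3 (int n) - E3 (int n)) (L3 (int n) - S3 (int n))"
    by (rule bij_betw_of_tracing[OF tracing_L3 E3_eq_chain_ends])
  show "chain_decomposition (L3 (int n)) (chain_from (int n) ` S3 (int n))"
    unfolding chain_decomposition_def
    using partition_on_of_tracing(1)[OF tracing_L3, of "int n", folded chain_from] chain_from_is_chain
    by blast
  show "inj_on (chain_from (int n)) (S3 (int n))"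
    unfolding chain_from by (rule partition_on_of_tracing(2)[OF tracing_L3])
next
  fix m i assume m: "m \<in> S3 (int n)" and i: "i < chain_len (int n) m"
  from m obtain k l where kl: "m = (4 * k + l, 2 * k, 0)" "0 \<le> k" "0 \<le> l" "l \<noteq> 1" "4 * k + l \<le> int n"
    by (rule mem_S3E)
  have "(phi ^^ j) m \<in> L3 (int n)" if "j \<le> chain_len (int n) m" for j
    using bij_betw_imp_surj_on[OF tracing_L3] m that by force
  then have mem: "(phi ^^ i) m \<in> L3 (int n)" "(phi ^^ Suc i) m \<in> L3 (int n)"
    using i less_imp_le Suc_leI by blast+
  show "covers_in (L3 (int n)) ((phi ^^ i) m) ((phi ^^ Suc i) m)"
    using mem unfolding kl(1) funpow_phi_eq_orbit[OF kl(2-4)]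
    by (rule covers_in_if_rank3_Suc) (simp_all add: orbit_mono rank3_orbit[OF kl(2-4)])
qed (rule S3_eq_bottoms chain_end_mem_E3 type_I_chain_if type_II_chain_if; blast)+

end
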